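(* Let $N\ge 1$ be an integer and consider an $N$-box PPS scenario (as defined in the context) with pre-selected state $\rho_I$, post-selected state $\rho_F$ and box basis $B=\{|b\rangle\}_{b=1}^{N+1}$ of $\mathbb{C}^{N+1}$. If either $\rho_I$ or $\rho_F$ is incoherent with respect to the basis $B$, then the ABL statistics satisfy $$\sum_{b=1}^{N}p(b\mid\rho_I,\rho_F,\mathcal{M}_b)\le 1 .$$
   Context: A state on $\mathbb{C}^d$ is a density operator (positive semidefinite, trace one). A state $\rho$ is incoherent with respect to an orthonormal basis $\{|a\rangle\}_a$ if $\langle a|\rho|a'\rangle=0$ for all $a\ne a'$, and coherent otherwise. $N$-box PPS scenario. The data are states $\rho_I$ (pre-selected) and $\rho_F$ (post-selected) on $\mathbb{C}^{N+1}$, and an orthonormal basis $B=\{|b\rangle\}_{b=1}^{N+1}$ of $\mathbb{C}^{N+1}$ (the box basis). Write $\Pi_b=|b\rangle\langle b|$ and $\Pi_b^{\perp}=\mathbb{1}-\Pi_b$. The intermediate measurement $\mathcal{M}_b=\{\Pi_b,\mathbb{1}-\Pi_b\}$ is considered for $b\in\{1,\dots,N\}$ only ($\mathcal{M}_{N+1}$ is excluded), and the post-selection measurement is $\mathcal{M}_F=\{\rho_F,\mathbb{1}-\rho_F\}$, with "pass" denoting outcome $\rho_F$. The probabilities (Lüders rule) are $$p(b,\mathrm{pass})=\mathrm{Tr}[\rho_F\Pi_b\rho_I\Pi_b],\qquad p(\neg b,\mathrm{pass})=\mathrm{Tr}[\rho_F\Pi_b^{\perp}\rho_I\Pi_b^{\perp}],\qquad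 p(\mathrm{pass}\mid\rho_I,\mathcal{M}_F)=\mathrm{Tr}[\rho_F\rho_I].$$ The scenario is required to satisfy: (i) operational non-disturbance: $p(b,\mathrm{pass})+p(\neg b,\mathrm{pass})=p(\mathrm{pass}\mid\rho_I,\mathcal{M}_F)$ for all $b\in\{1,\dots,N\}$; (ii) $p(\mathrm{pass}\mid\rho_I,\mathcal{M}_F)=\mathrm{Tr}[\rho_F\rho_I]\neq 0$; (iii) no two boxes are found occupied in sequential intermediate measurements without post-selection: $p(b,b'\mid\rho_I,\mathcal{M}_b,\mathcal{M}_{b'})=\mathrm{Tr}[\Pi_{b'}\Pi_b\rho_I\Pi_b\Pi_{b'}]=0$ for all $b\ne b'$. ABL rule: for $b\in\{1,\dots,N\}$, $$p(b\mid\rho_I,\rho_F,\mathcal{M}_b)=\frac{p(b,\mathrm{pass})}{p(b,\mathrm{pass})+p(\neg b,\mathrm{pass})}.$$ *)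

theory Defs
  imports "HOL-Analysis.Analysis"
begin

section \<open>States on a finite-dimensional complex Hilbert space\<close>

text \<open>The space is \<open>complex ^ 'n\<close>, of dimension \<open>CARD('n)\<close>. The inner product is
  conjugate-linear in the first argument (Dirac convention).\<close>

definition braket :: "complex ^ 'n \<Rightarrow> complex ^ 'n \<Rightarrow> complex" where
  "braket v w = (\<Sum>i\<in>UNIV. cnj (v $ i) * w $ i)"

definition ketbra :: "complex ^ 'n \<Rightarrow> complex ^ 'n \<Rightarrow> complex ^ 'n ^ 'n" where
  "ketbra v w = (\<chi> i j. v $ i * cnj (w $ j))"

definition adjoint_mat :: "complex ^ 'n ^ 'n \<Rightarrow> complex ^ 'n ^ 'n" where
  "adjoint_mat A = (\<chi> i j. cnj (A $ j $ i))"

definition hermitian :: "complex ^ 'n ^ 'n \<Rightarrow> bool" where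
  "hermitian A \<longleftrightarrow> adjoint_mat A = A"

definition positive_semidefinite :: "complex ^ 'n ^ 'n \<Rightarrow> bool" where
  "positive_semidefinite A \<longleftrightarrow> hermitian A \<and> (\<forall>v. 0 \<le> Re (braket v (A *v v)))"

definition density_operator :: "complex ^ 'n ^ 'n \<Rightarrow> bool" where
  "density_operator \<rho> \<longleftrightarrow> positive_semidefinite \<rho> \<and> trace \<rho> = 1"

text \<open>The families \<open>e 1, \<dots>, e d\<close> are indexed by \<open>{1..d}\<close>; values of \<open>e\<close> outside this
  range are irrelevant.\<close>

definition orthonormal_basis :: "nat \<Rightarrow> (nat \<Rightarrow> complex ^ 'n) \<Rightarrow> bool" where
  "orthonormal_basis d e \<longleftrightarrow>
     (\<forall>a\<in>{1..d}. \<forall>a'\<in>{1..d}. braket (e a) (e a') = (if a = a' then 1 else 0)) \<and>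
     vec.span (e ` {1..d}) = UNIV"

definition incoherent :: "nat \<Rightarrow> (nat \<Rightarrow> complex ^ 'n) \<Rightarrow> complex ^ 'n ^ 'n \<Rightarrow> bool" where
  "incoherent d e \<rho> \<longleftrightarrow>
     (\<forall>a\<in>{1..d}. \<forall>a'\<in>{1..d}. a \<noteq> a' \<longrightarrow> braket (e a) (\<rho> *v e a') = 0)"


section \<open>Measurement probabilities\<close>

text \<open>The probabilities below are traces that are real whenever the operators involved are
  Hermitian (lemmas \<open>Im_trace_hermitian\<close>, \<open>Im_trace_hermitian_mult\<close> and
  \<open>hermitian_sandwich\<close>), so taking \<open>Re\<close> only changes the type.\<close>

lemma adjoint_mat_mult: "adjoint_mat (A ** B) = adjoint_mat B ** adjoint_mat A"
  by (simp add: adjoint_mat_def matrix_matrix_mult_def vec_eq_iff mult.commute)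

lemma Im_trace_hermitian:
  assumes "hermitian A"
  shows "Im (trace A) = 0"
proof -
  have "cnj (A $ i $ i) = A $ i $ i" for i
    using assms by (simp add: hermitian_def adjoint_mat_def vec_eq_iff)
  then have "cnj (trace A) = trace A"
    by (simp add: trace_def)
  then have "Im (cnj (trace A)) = Im (trace A)"
    by (rule arg_cong)
  then show ?thesis
    by simp
qed

lemma Im_trace_hermitian_mult:
  assumes "hermitian A" "hermitian B"
  shows "Im (trace (A ** B)) = 0"
proof -
  have "cnj (trace (A ** B)) = trace (adjoint_mat (A ** B))"
    by (simp add: trace_def adjoint_mat_def)
  also have "\<dots> = trace (A ** B)"
    using assms trace_mul_sym[of B A] by (simp add: adjoint_mat_mult hermitian_def)
  finally have "Im (cnj (trace (A ** B))) = Im (trace (A ** B))"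
    by (rule arg_cong)
  then show ?thesis
    by simp
qed

lemma hermitian_sandwich:
  assumes "hermitian P" "hermitian A"
  shows "hermitian (P ** A ** P)"
  using assms by (simp add: hermitian_def adjoint_mat_mult matrix_mul_assoc)

lemma hermitian_ketbra: "hermitian (ketbra v v)"
  by (simp add: hermitian_def adjoint_mat_def ketbra_def vec_eq_iff mult.commute)

text \<open>\<open>p(pass | \<rho>I, M_F)\<close>, without intermediate measurement.\<close>

definition prob_pass :: "complex ^ 'n ^ 'n \<Rightarrow> complex ^ 'n ^ 'n \<Rightarrow> real" where
  "prob_pass \<rho>I \<rho>F = Re (trace (\<rho>F ** \<rho>I))"

definition box_proj :: "(nat \<Rightarrow> complex ^ 'n) \<Rightarrow> nat \<Rightarrow> complex ^ 'n ^ 'n" where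
  "box_proj e b = ketbra (e b) (e b)"

definition box_proj_perp :: "(nat \<Rightarrow> complex ^ 'n) \<Rightarrow> nat \<Rightarrow> complex ^ 'n ^ 'n" where
  "box_proj_perp e b = mat 1 - box_proj e b"

definition prob_box_pass ::
  "complex ^ 'n ^ 'n \<Rightarrow> complex ^ 'n ^ 'n \<Rightarrow> (nat \<Rightarrow> complex ^ 'n) \<Rightarrow> nat \<Rightarrow> real" where
  "prob_box_pass \<rho>I \<rho>F e b = Re (trace (\<rho>F ** box_proj e b ** \<rho>I ** box_proj e b))"

definition prob_not_box_pass ::
  "complex ^ 'n ^ 'n \<Rightarrow> complex ^ 'n ^ 'n \<Rightarrow> (nat \<Rightarrow> complex ^ 'n) \<Rightarrow> nat \<Rightarrow> real" where
  "prob_not_box_pass \<rho>I \<rho>F e b =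
     Re (trace (\<rho>F ** box_proj_perp e b ** \<rho>I ** box_proj_perp e b))"

text \<open>Boxes \<open>b\<close> and then \<open>b'\<close> found occupied in sequential measurements, no post-selection.\<close>

definition prob_two_boxes ::
  "complex ^ 'n ^ 'n \<Rightarrow> (nat \<Rightarrow> complex ^ 'n) \<Rightarrow> nat \<Rightarrow> nat \<Rightarrow> real" where
  "prob_two_boxes \<rho>I e b b' =
     Re (trace (box_proj e b' ** box_proj e b ** \<rho>I ** box_proj e b ** box_proj e b'))"

definition abl_prob ::
  "complex ^ 'n ^ 'n \<Rightarrow> complex ^ 'n ^ 'n \<Rightarrow> (nat \<Rightarrow> complex ^ 'n) \<Rightarrow> nat \<Rightarrow> real" where
  "abl_prob \<rho>I \<rho>F e b =
     prob_box_pass \<rho>I \<rho>F e b / (prob_box_pass \<rho>I \<rho>F e b + prob_not_box_pass \<rho>I \<rho>F e b)"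


section \<open>Box scenarios with pre- and post-selection\<close>

text \<open>The intermediate measurements are those of boxes \<open>1, \<dots>, N\<close> only, although the box basis
  has \<open>N + 1\<close> elements; the conjuncts on probabilities are operational non-disturbance,
  possible post-selection, and no two boxes found occupied.\<close>

definition N_box_PPS_scenario ::
  "nat \<Rightarrow> complex ^ 'n ^ 'n \<Rightarrow> complex ^ 'n ^ 'n \<Rightarrow> (nat \<Rightarrow> complex ^ 'n) \<Rightarrow> bool" where
  "N_box_PPS_scenario N \<rho>I \<rho>F e \<longleftrightarrow>
     CARD('n) = N + 1 \<and>
     density_operator \<rho>I \<and> density_operator \<rho>F \<and>
     orthonormal_basis (N + 1) e \<and>
     (\<forall>b\<in>{1..N}. prob_box_pass \<rho>I \<rho>F e b + prob_not_box_pass \<rho>I \<rho>F e b = prob_pass \<rho>I \<rho>F) \<and>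
     prob_pass \<rho>I \<rho>F \<noteq> 0 \<and>
     (\<forall>b\<in>{1..N}. \<forall>b'\<in>{1..N}. b \<noteq> b' \<longrightarrow> prob_two_boxes \<rho>I e b b' = 0)"

end

theory Submission
  imports Defs
begin

text \<open>In the box basis, \<open>Tr[\<rho>F \<rho>I]\<close> is the double sum of
  \<open>\<langle>a|\<rho>F|a'\<rangle> \<langle>a'|\<rho>I|a\<rangle>\<close>. If one of the states is incoherent, only the diagonal
  terms \<open>a = a'\<close> survive; these are the nonnegative numbers \<open>p(a, pass)\<close>. By
  non-disturbance \<open>Tr[\<rho>F \<rho>I]\<close> is the common denominator of the ABL probabilities, so their
  sum over the first \<open>N\<close> boxes omits only the term of box \<open>N + 1\<close>.\<close>

lemma braket_sum_right: "braket v (sum f S) = (\<Sum>a\<in>S. braket v (f a))"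
  by (simp add: braket_def sum_distrib_left) (rule sum.swap)

lemma braket_scale_right: "braket v (c *s w) = c * braket v w"
  by (simp add: braket_def sum_distrib_left mult.left_commute)

lemma ketbra_mult_vec: "ketbra u v *v w = braket v w *s u"
  by (simp add: ketbra_def braket_def matrix_vector_mult_def vec_eq_iff sum_distrib_left
      mult_ac)

lemma trace_mult_ketbra: "trace (A ** ketbra v w) = braket w (A *v v)"
  by (simp add: trace_def matrix_matrix_mult_def ketbra_def braket_def matrix_vector_mult_def
      sum_distrib_left mult_ac)

lemma cnj_braket: "cnj (braket v w) = braket w v"
  by (simp add: braket_def mult.commute)

lemma braket_adjoint: "braket v (A *v w) = braket (adjoint_mat A *v v) w"
proof -
  have "braket v (A *v w) = (\<Sum>i\<in>UNIV. \<Sum>j\<in>UNIV. cnj (v $ i) * (A $ i $ j * w $ j))"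
    by (simp add: braket_def matrix_vector_mult_def sum_distrib_left)
  also have "\<dots> = (\<Sum>j\<in>UNIV. \<Sum>i\<in>UNIV. cnj (v $ i) * (A $ i $ j * w $ j))"
    by (rule sum.swap)
  also have "\<dots> = braket (adjoint_mat A *v v) w"
    by (simp add: braket_def adjoint_mat_def matrix_vector_mult_def sum_distrib_left mult_ac)
  finally show ?thesis .
qed

text \<open>Moving \<open>A\<close> to the other argument and conjugating returns the same number,
  so it is real.\<close>

lemma Im_braket_hermitian:
  assumes "hermitian A"
  shows "Im (braket v (A *v v)) = 0"
proof -
  have "cnj (braket v (A *v v)) = braket v (A *v v)"
    using assms by (metis braket_adjoint cnj_braket hermitian_def)
  then have "Im (cnj (braket v (A *v v))) = Im (braket v (A *v v))"
    by (rule arg_cong)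
  then show ?thesis
    by simp
qed

text \<open>The sum of the projectors is linear and, by orthonormality, fixes every basis vector;
  hence it fixes their span, which is the whole space.\<close>

lemma orthonormal_basis_expansion:
  assumes "orthonormal_basis d e"
  shows "v = (\<Sum>a\<in>{1..d}. braket (e a) v *s e a)"
proof -
  \<comment> \<open>With the coefficients hidden in matrices, the span induction only needs
    linearity of \<open>*v\<close>.\<close>
  let ?P = "\<lambda>v. \<Sum>a\<in>{1..d}. ketbra (e a) (e a) *v v"
  have fixed: "?P (e b) = e b" if "b \<in> {1..d}" for b
  proof -
    have "?P (e b) = (\<Sum>a\<in>{1..d}. if a = b then e b else 0)"
      using assms that
      by (intro sum.cong) (auto simp: orthonormal_basis_def ketbra_mult_vec)
    then show ?thesis
      using that by simp
  qed
  have "v \<in> vec.span (e ` {1..d})"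
    using assms by (simp add: orthonormal_basis_def)
  then have "?P v = v"
  proof (induction rule: vec.span_induct_alt)
    case base
    then show ?case
      by simp
  next
    case (step c x y)
    have "?P (c *s x + y) = c *s ?P x + ?P y"
      by (simp only: matrix_vector_right_distrib vector_scalar_commute sum.distrib
          vec.scale_sum_right)
    moreover have "?P x = x"
      using step.hyps fixed by blast
    ultimately show ?case
      using step.IH by (simp only:)
  qed
  then show ?thesis
    by (simp add: ketbra_mult_vec)
qed

lemma sum_ketbra_orthonormal_basis:
  assumes "orthonormal_basis d e"
  shows "(\<Sum>a\<in>{1..d}. ketbra (e a) (e a)) = mat 1"
proof -
  have sum_mult_vec: "(\<Sum>a\<in>S. M a) *v v = (\<Sum>a\<in>S. M a *v v)"
    for S and M :: "nat \<Rightarrow> complex ^ 'a ^ 'a" and v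
    by (induction S rule: infinite_finite_induct) (simp_all add: matrix_vector_mult_add_rdistrib)
  show ?thesis
    by (simp only: matrix_eq sum_mult_vec ketbra_mult_vec matrix_vector_mul_lid
        orthonormal_basis_expansion[OF assms, symmetric] simp_thms)
qed

text \<open>Multiply \<open>A\<close> by the resolution of the identity and evaluate the trace
  projector by projector.\<close>

lemma trace_orthonormal_basis:
  assumes "orthonormal_basis d e"
  shows "trace A = (\<Sum>a\<in>{1..d}. braket (e a) (A *v e a))"
proof -
  have mult_sum: "A ** (\<Sum>a\<in>S. M a) = (\<Sum>a\<in>S. A ** M a)"
    for S and M :: "nat \<Rightarrow> complex ^ 'a ^ 'a"
    by (induction S rule: infinite_finite_induct) (simp_all add: matrix_add_ldistrib)
  have trace_sum: "trace (\<Sum>a\<in>S. M a) = (\<Sum>a\<in>S. trace (M a))"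
    for S and M :: "nat \<Rightarrow> complex ^ 'a ^ 'a"
    by (simp add: trace_def) (rule sum.swap)
  have "trace A = trace (A ** (\<Sum>a\<in>{1..d}. ketbra (e a) (e a)))"
    by (simp only: sum_ketbra_orthonormal_basis[OF assms] matrix_mul_rid)
  then show ?thesis
    by (simp only: mult_sum trace_sum trace_mult_ketbra)
qed

lemma trace_mult_orthonormal_basis:
  assumes "orthonormal_basis d e"
  shows "trace (A ** B) =
    (\<Sum>a\<in>{1..d}. \<Sum>a'\<in>{1..d}. braket (e a) (A *v e a') * braket (e a') (B *v e a))"
proof -
  have expand: "braket v (A *v w) = (\<Sum>a'\<in>{1..d}. braket v (A *v e a') * braket (e a') w)" for v w
  proof -
    \<comment> \<open>With \<open>A\<close> moved to the left argument, the expansion of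
      \<open>w\<close> stands alone on the right, where \<open>braket\<close> is linear.\<close>
    have "braket v (A *v w) = braket (adjoint_mat A *v v) (\<Sum>a'\<in>{1..d}. braket (e a') w *s e a')"
      by (simp only: braket_adjoint orthonormal_basis_expansion[OF assms, symmetric])
    then show ?thesis
      by (simp add: braket_sum_right braket_scale_right braket_adjoint mult.commute)
  qed
  have "trace (A ** B) = (\<Sum>a\<in>{1..d}. braket (e a) (A *v (B *v e a)))"
    by (simp only: trace_orthonormal_basis[OF assms] matrix_vector_mul_assoc)
  also have "\<dots> = (\<Sum>a\<in>{1..d}. \<Sum>a'\<in>{1..d}.
      braket (e a) (A *v e a') * braket (e a') (B *v e a))"
    by (intro sum.cong[OF refl] expand)
  finally show ?thesis .
qed

text \<open>For \<open>a \<noteq> a'\<close> each product in the double sum contains an off-diagonal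
  entry of both \<open>A\<close> and \<open>B\<close>, so incoherence of either one kills
  it.\<close>

lemma trace_mult_incoherent:
  assumes "orthonormal_basis d e" and "incoherent d e A \<or> incoherent d e B"
  shows "trace (A ** B) = (\<Sum>a\<in>{1..d}. braket (e a) (A *v e a) * braket (e a) (B *v e a))"
proof -
  have "(\<Sum>a'\<in>{1..d}. braket (e a) (A *v e a') * braket (e a') (B *v e a)) =
      braket (e a) (A *v e a) * braket (e a) (B *v e a)" (is "sum ?f _ = _")
    if "a \<in> {1..d}" for a
  proof -
    have "sum ?f {1..d} = sum ?f {a}"
      using assms(2) that by (intro sum.mono_neutral_right) (auto simp: incoherent_def)
    then show ?thesis
      by simp
  qed
  then show ?thesis
    unfolding trace_mult_orthonormal_basis[OF assms(1)] by (rule sum.cong[OF refl])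
qed

text \<open>The trace against the outer projector is an expectation value in \<open>e b\<close>; the
  inner projector splits it into two factors.\<close>

lemma prob_box_pass_eq:
  "prob_box_pass \<rho>I \<rho>F e b = Re (braket (e b) (\<rho>F *v e b) * braket (e b) (\<rho>I *v e b))"
  by (simp only: prob_box_pass_def box_proj_def trace_mult_ketbra ketbra_mult_vec
      braket_scale_right vector_scalar_commute mult.commute matrix_vector_mul_assoc[symmetric])

text \<open>Both diagonal entries are real by hermiticity, so the real part of their product is the
  product of their nonnegative real parts.\<close>

lemma prob_box_pass_nonneg:
  assumes "density_operator \<rho>I" and "density_operator \<rho>F"
  shows "0 \<le> prob_box_pass \<rho>I \<rho>F e b"
  using assms
  by (simp add: prob_box_pass_eq density_operator_def positive_semidefinite_def
      Im_braket_hermitian)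

lemma prob_pass_incoherent:
  assumes "orthonormal_basis d e" and "incoherent d e \<rho>I \<or> incoherent d e \<rho>F"
  shows "prob_pass \<rho>I \<rho>F = (\<Sum>a\<in>{1..d}. prob_box_pass \<rho>I \<rho>F e a)"
  \<comment> \<open>\<open>prob_pass\<close> multiplies \<open>\<rho>F\<close> by
    \<open>\<rho>I\<close> in this order, hence the swapped disjunction.\<close>
  using trace_mult_incoherent[OF assms(1) assms(2)[unfolded disj_commute[of "incoherent d e \<rho>I"]]]
  by (simp only: prob_pass_def prob_box_pass_eq Re_sum)

theorem mainTheorem1:
  fixes N :: nat
    and \<rho>I \<rho>F :: "complex ^ 'n ^ 'n"
    and e :: "nat \<Rightarrow> complex ^ 'n"
  assumes "N \<ge> 1"
    and "N_box_PPS_scenario N \<rho>I \<rho>F e"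
    and "incoherent (N + 1) e \<rho>I \<or> incoherent (N + 1) e \<rho>F"
  shows "(\<Sum>b = 1..N. abl_prob \<rho>I \<rho>F e b) \<le> 1"
proof -
  let ?p = "prob_box_pass \<rho>I \<rho>F e"
  have nonneg: "0 \<le> ?p b" for b
    using assms(2) by (simp add: N_box_PPS_scenario_def prob_box_pass_nonneg)
  have pass: "prob_pass \<rho>I \<rho>F = (\<Sum>b = 1..N. ?p b) + ?p (N + 1)"
    using assms(2,3) prob_pass_incoherent[of "N + 1" e \<rho>I \<rho>F]
    by (simp add: N_box_PPS_scenario_def)
  \<comment> \<open>Non-disturbance gives all \<open>N\<close> ABL quotients the same
    denominator.\<close>
  have "(\<Sum>b = 1..N. abl_prob \<rho>I \<rho>F e b) = (\<Sum>b = 1..N. ?p b) / prob_pass \<rho>I \<rho>F"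
    using assms(2) by (simp add: abl_prob_def N_box_PPS_scenario_def sum_divide_distrib)
  \<comment> \<open>The denominator is the numerator plus the nonnegative term of the unmeasured box
    \<open>N + 1\<close>.\<close>
  also have "\<dots> \<le> 1"
    using nonneg by (intro divide_le_eq_1[THEN iffD2]) (auto simp: pass sum_nonneg less_le)
  finally show ?thesis .
qed

end
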